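(* Let $A=\{a_1,\dots,a_k\}$ be a set of real numbers with $k>2$ and $a_1<\dots<a_k$. Suppose that for some $d,o\in\mathbb{R}$ with $0<d\le a_k-a_1$ we have $N_{d,o}(A)<c_2$, where $c_2$ is a positive constant. Then there exists a positive integer $q$ such that $$\max_{1\le i\le k}\|q\alpha_i\|<6c_2\,q^{-1/(k-2)}\quad\text{and}\quad\left|\frac{a_k-a_1}{d}-q\right|<3c_2\,q^{-1/(k-2)},$$ where $\alpha_i=(a_i-a_1)/(a_k-a_1)$ for $i=1,\dots,k$.
   Context: $\|x\|$ denotes the distance from the real number $x$ to the nearest integer. For $x,d\in\mathbb{R}$ with $d>0$, write $|x-d\mathbb{Z}|:=\min_{m\in\mathbb{Z}}|x-dm|$. For a finite set $A=\{a_1,\dots,a_k\}\subset\mathbb{R}$ of $k\ge 3$ distinct points and $d>0$, $o\in\mathbb{R}$, define $$N_{d,o}(A)=\frac{\max_{1\le i\le k}|a_i-o-d\mathbb{Z}|}{d}\left(\frac{\max_{i<j}|a_i-a_j|}{d}\right)^{1/(k-2)}.$$ *)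

theory Defs
  imports Complex_Main
begin

(* |x - dZ|.  The minimum over the integers is written as an infimum;
   lattice_dist_attained shows that it is a minimum. *)
definition lattice_dist :: "real \<Rightarrow> real \<Rightarrow> real" where
  "lattice_dist d x = (INF m::int. \<bar>x - d * of_int m\<bar>)"

definition nearest_int_dist :: "real \<Rightarrow> real" where
  "nearest_int_dist x = (INF m::int. \<bar>x - of_int m\<bar>)"

(* N_{d,u}(A), with k = card A and offset u; meaningful for finite A with card A \<ge> 3 and d > 0.
   The maximum over i < j of |a_i - a_j| is taken over pairs of distinct points of A. *)
definition lattice_approx :: "real \<Rightarrow> real \<Rightarrow> real set \<Rightarrow> real" where
  "lattice_approx d u A =
     Max ((\<lambda>a. lattice_dist d (a - u)) ` A) / d *
     (Max {\<bar>a - b\<bar> | a b. a \<in> A \<and> b \<in> A \<and> a \<noteq> b} / d) powr (1 / (real (card A) - 2))"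

lemma lattice_dist_attained:
  assumes "d > 0"
  shows "\<exists>m::int. lattice_dist d x = \<bar>x - d * of_int m\<bar>"
    and "lattice_dist d x \<le> \<bar>x - d * of_int n\<bar>"
proof -
  have min: "\<bar>x - d * of_int (round (x / d))\<bar> \<le> \<bar>x - d * of_int m\<bar>" for m :: int
  proof -
    have "d * \<bar>x / d - of_int (round (x / d))\<bar> \<le> d * \<bar>x / d - of_int m\<bar>"
      using assms round_diff_minimal[of "x / d" m] by (intro mult_left_mono) auto
    moreover have "d * \<bar>x / d - of_int j\<bar> = \<bar>x - d * of_int j\<bar>" for j :: int
      using assms abs_mult[of d "x / d - of_int j"] by (simp add: algebra_simps)
    ultimately show ?thesis by simp
  qed
  have eq: "lattice_dist d x = \<bar>x - d * of_int (round (x / d))\<bar>"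
    unfolding lattice_dist_def by (rule cInf_eq_minimum) (use min in auto)
  show "\<exists>m::int. lattice_dist d x = \<bar>x - d * of_int m\<bar>" using eq by blast
  show "lattice_dist d x \<le> \<bar>x - d * of_int n\<bar>" using eq min by simp
qed

lemma nearest_int_dist_eq: "nearest_int_dist x = lattice_dist 1 x"
  by (simp add: nearest_int_dist_def lattice_dist_def)

end

theory Submission
  imports Defs
begin

text \<open>Put \<open>L = (a k - a 1) / d \<ge> 1\<close>, and let \<open>e\<close> be the largest distance of \<open>(a i - u) / d\<close> to
  the integers, so that \<open>e * L powr s < c\<^sub>2\<close> with \<open>s = 1 / (k - 2) \<le> 1\<close>. Differences of two of the
  numbers \<open>(a i - u) / d\<close> are within \<open>2 * e\<close> of an integer, in particular \<open>L\<close> is. Take \<open>q\<close> to be the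
  integer nearest to \<open>L\<close>; then \<open>q\<close> times \<open>(a i - a 1) / (a k - a 1)\<close> is within \<open>4 * e\<close> of an integer.
  Finally \<open>q \<le> L + 1/2 \<le> 3/2 * L\<close>, so replacing \<open>L\<close> by \<open>q\<close> costs at most a factor \<open>3/2\<close>.\<close>

text \<open>The lattice points closest to \<open>x\<close> and \<open>y\<close> differ by a multiple
  of \<open>d\<close>, and the two errors add up. Applied to \<open>a i - u\<close> and
  \<open>a 1 - u\<close>, this eliminates the offset.\<close>

lemma lattice_dist_diff:
  assumes "d > 0" "lattice_dist d x \<le> d * e" "lattice_dist d y \<le> d * e"
  shows "\<exists>m::int. \<bar>(x - y) / d - of_int m\<bar> \<le> 2 * e"
proof -
  obtain m n :: int where mn: "\<bar>x - d * of_int m\<bar> \<le> d * e" "\<bar>y - d * of_int n\<bar> \<le> d * e"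
    using lattice_dist_attained(1)[OF \<open>d > 0\<close>] assms(2,3) by metis
  have "(x - d * of_int m) - (y - d * of_int n) = d * ((x - y) / d - of_int (m - n))"
    using \<open>d > 0\<close> by (simp add: field_simps)
  then have "d * \<bar>(x - y) / d - of_int (m - n)\<bar> = \<bar>(x - d * of_int m) - (y - d * of_int n)\<bar>"
    using \<open>d > 0\<close> by (simp add: abs_mult)
  also have "\<dots> \<le> d * (2 * e)"
    using mn by linarith
  finally show ?thesis
    using \<open>d > 0\<close> by (intro exI[of _ "m - n"]) simp
qed

lemma nearest_int_dist_le: "nearest_int_dist x \<le> \<bar>x - of_int m\<bar>"
  using lattice_dist_attained(2)[of 1 x m] by (simp add: nearest_int_dist_eq)

text \<open>As \<open>t\<close> lies in the unit interval, replacing \<open>L\<close> by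
  \<open>q\<close> moves the product with \<open>t\<close> no further than it moves \<open>L\<close>
  itself.\<close>

lemma nearest_int_dist_scale_le:
  fixes L q :: real and m :: int
  assumes "\<bar>L - q\<bar> \<le> e" "\<bar>L * t - of_int m\<bar> \<le> e'" "0 \<le> t" "t \<le> 1"
  shows "nearest_int_dist (q * t) \<le> e + e'"
proof -
  have "\<bar>(L - q) * t\<bar> \<le> e"
    using assms mult_mono[of "\<bar>L - q\<bar>" e t 1] by (simp add: abs_mult)
  then have "\<bar>q * t - of_int m\<bar> \<le> e + e'"
    using assms(2) by (simp add: algebra_simps)
  then show ?thesis
    using nearest_int_dist_le order_trans by blast
qed

text \<open>The bound \<open>r powr s \<le> r\<close> keeps the constant independent of the
  exponent, hence of \<open>k\<close>.\<close>

lemma powr_neg_le_of_le_mult: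
  fixes L q r s :: real
  assumes "0 < L" "0 < q" "q \<le> r * L" "1 \<le> r" "0 \<le> s" "s \<le> 1"
  shows "L powr (- s) \<le> r * q powr (- s)"
proof -
  have "q powr s \<le> (r * L) powr s"
    using assms by (intro powr_mono2) auto
  also have "\<dots> = r powr s * L powr s"
    using assms by (simp add: powr_mult)
  also have "\<dots> \<le> r * L powr s"
    using assms powr_mono[of s 1 r] by (intro mult_right_mono) auto
  finally show ?thesis
    using assms by (simp add: powr_minus field_simps)
qed

text \<open>Unpacks both maxima: the witness is the largest lattice distance divided by
  \<open>d\<close>, and the diameter is only bounded below by the single difference
  \<open>y - x\<close>.\<close>

lemma lattice_approx_lower:
  assumes "finite A" "x \<in> A" "y \<in> A" "x < y" "d > 0" "card A \<ge> 2"
  obtains e where "0 \<le> e" "\<And>z. z \<in> A \<Longrightarrow> lattice_dist d (z - u) \<le> d * e"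
    "e * ((y - x) / d) powr (1 / (real (card A) - 2)) \<le> lattice_approx d u A"
proof
  define M where "M = Max ((\<lambda>a. lattice_dist d (a - u)) ` A)"
  define D where "D = {\<bar>a - b\<bar> | a b. a \<in> A \<and> b \<in> A \<and> a \<noteq> b}"
  have M: "lattice_dist d (z - u) \<le> M" if "z \<in> A" for z
    unfolding M_def using \<open>finite A\<close> that by (intro Max_ge) auto
  then show "lattice_dist d (z - u) \<le> d * (M / d)" if "z \<in> A" for z
    using that \<open>d > 0\<close> by simp
  have "0 \<le> lattice_dist d (x - u)"
    using lattice_dist_attained(1)[OF \<open>d > 0\<close>] by (metis abs_ge_zero)
  with M[OF \<open>x \<in> A\<close>] show e: "0 \<le> M / d"
    using \<open>d > 0\<close> by simp
  have "finite D"
    by (rule finite_subset[of _ "(\<lambda>(a, b). \<bar>a - b\<bar>) ` (A \<times> A)"])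
      (use \<open>finite A\<close> in \<open>auto simp: D_def\<close>)
  moreover have "y - x \<in> D"
    unfolding D_def using assms by (intro CollectI exI[of _ y] exI[of _ x]) auto
  ultimately have "y - x \<le> Max D"
    by simp
  \<comment> \<open>Monotonicity needs a nonnegative exponent; for \<open>card A = 2\<close> it is
    \<open>1 / 0 = 0\<close>.\<close>
  then have "((y - x) / d) powr (1 / (real (card A) - 2))
      \<le> (Max D / d) powr (1 / (real (card A) - 2))"
    using assms by (intro powr_mono2 divide_right_mono) auto
  from mult_left_mono[OF this e]
  show "M / d * ((y - x) / d) powr (1 / (real (card A) - 2)) \<le> lattice_approx d u A"
    by (simp add: lattice_approx_def M_def D_def)
qed

theorem theorem2p4:
  fixes A :: "real set" and a :: "nat \<Rightarrow> real" and k :: nat and d u c\<^sub>2 :: real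
  assumes "k > 2"
    and "A = a ` {1..k}"
    and "strict_mono_on {1..k} a"
    and "0 < d" and "d \<le> a k - a 1"
    and "0 < c\<^sub>2"
    and "lattice_approx d u A < c\<^sub>2"
  shows "\<exists>q::nat. q > 0 \<and>
    (MAX i\<in>{1..k}. nearest_int_dist (real q * ((a i - a 1) / (a k - a 1))))
      < 6 * c\<^sub>2 * real q powr (- (1 / (real k - 2))) \<and>
    \<bar>(a k - a 1) / d - real q\<bar> < 3 * c\<^sub>2 * real q powr (- (1 / (real k - 2)))"
proof -
  define s where "s = 1 / (real k - 2)"
  define L where "L = (a k - a 1) / d"
  have s: "0 \<le> s" "s \<le> 1"
    using \<open>k > 2\<close> by (auto simp: s_def field_simps)
  have L: "1 \<le> L"
    using assms by (simp add: L_def)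
  have mem: "a i \<in> A" if "i \<in> {1..k}" for i
    using that assms(2) by blast
  have card: "card A = k"
    using assms(2,3) by (simp add: card_image strict_mono_on_imp_inj_on)
  have ends: "a 1 \<in> A" "a k \<in> A" "a 1 < a k"
    using assms mem by auto
  have "finite A" "card A \<ge> 2"
    using assms(1,2) card by auto
  from lattice_approx_lower[OF this(1) ends \<open>0 < d\<close> this(2)]
  obtain e where e: "0 \<le> e" "\<And>z. z \<in> A \<Longrightarrow> lattice_dist d (z - u) \<le> d * e"
    and "e * L powr s \<le> lattice_approx d u A"
    unfolding card s_def[symmetric] L_def[symmetric] by blast
  with assms(7) have "e * L powr s < c\<^sub>2"
    by simp
  then have eL: "e < c\<^sub>2 * L powr (- s)"
    using L by (simp add: powr_minus field_simps)
  have near: "\<exists>m::int. \<bar>(a i - a 1) / d - of_int m\<bar> \<le> 2 * e" if "i \<in> {1..k}" for i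
    using lattice_dist_diff[OF \<open>0 < d\<close> e(2)[OF mem[OF that]] e(2)[OF ends(1)]] by simp

  define q where "q = nat (round L)"
  \<comment> \<open>The hypothesis \<open>d \<le> a k - a 1\<close>, in the form
    \<open>1 \<le> L\<close>, makes \<open>q\<close> positive.\<close>
  have "round L \<ge> 1"
    using L round_mono[of 1 L] by simp
  then have q: "q > 0" "real q = of_int (round L)"
    by (auto simp: q_def)
  have "real q \<le> 3/2 * L"
    using L q(2) of_int_round_le[of L] by simp
  from powr_neg_le_of_le_mult[OF _ _ this] have "L powr (- s) \<le> 3/2 * real q powr (- s)"
    using L q(1) s by simp
  then have "c\<^sub>2 * L powr (- s) \<le> c\<^sub>2 * (3/2 * real q powr (- s))"
    using \<open>0 < c\<^sub>2\<close> by (intro mult_left_mono) auto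
  \<comment> \<open>Here 3 is 2 times 3/2; the bound 6 below comes from
    \<open>4 * e\<close>.\<close>
  with eL have eq: "2 * e < 3 * c\<^sub>2 * real q powr (- s)"
    by simp
  obtain m :: int where "\<bar>L - of_int m\<bar> \<le> 2 * e"
    using near[of k] \<open>k > 2\<close> by (auto simp: L_def)
  \<comment> \<open>The nearest integer is at least as close to \<open>L\<close> as \<open>m\<close>
    is.\<close>
  then have Lq: "\<bar>L - real q\<bar> \<le> 2 * e"
    using round_diff_minimal[of L m] q(2) by (simp add: abs_minus_commute)

  have "nearest_int_dist (real q * ((a i - a 1) / (a k - a 1))) < 6 * c\<^sub>2 * real q powr (- s)"
    if i: "i \<in> {1..k}" for i
  proof -
    have t: "0 \<le> (a i - a 1) / (a k - a 1)" "(a i - a 1) / (a k - a 1) \<le> 1"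
      using strict_mono_on_leD[OF assms(3)] i ends(3) by (auto simp: field_simps)
    \<comment> \<open>The factor \<open>a k - a 1\<close> cancels, so the product is
      \<open>(a i - a 1) / d\<close>.\<close>
    obtain m :: int where "\<bar>L * ((a i - a 1) / (a k - a 1)) - of_int m\<bar> \<le> 2 * e"
      using near[OF i] ends(3) by (auto simp: L_def)
    from nearest_int_dist_scale_le[OF Lq this t] eq show ?thesis
      by simp
  qed
  then have "(MAX i\<in>{1..k}. nearest_int_dist (real q * ((a i - a 1) / (a k - a 1))))
      < 6 * c\<^sub>2 * real q powr (- s)"
    using \<open>k > 2\<close> by (subst Max_less_iff) auto
  then show ?thesis
    using q(1) Lq eq by (intro exI[of _ q]) (auto simp: s_def L_def)
qed

end
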